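(* If there exists an Eisenstein lattice $\Lambda$ in $\mathbb{C}^n$ whose covering-packing ratio does not exceed $3/2$, then $\chi(\mathbb{E}^{2n})\le 7^n$.
   Context: Let $\omega=e^{2\pi i/3}$ and $\mathbb{Z}[\omega]$ the ring of Eisenstein integers. An Eisenstein lattice in $\mathbb{C}^n$ is a set $\{\xi_1v_1+\dots+\xi_nv_n:\xi_1,\dots,\xi_n\in\mathbb{Z}[\omega]\}$ where $v_1,\dots,v_n\in\mathbb{C}^n$ are linearly independent over $\mathbb{C}$; identifying $\mathbb{C}^n$ with $\mathbb{E}^{2n}$, it is a full rank lattice in $\mathbb{E}^{2n}$. For a full rank lattice, the packing radius is half the length of a shortest nonzero lattice vector, the covering radius is the minimum $R$ such that closed balls of radius $R$ centered at lattice points cover the space, and the covering-packing ratio is their quotient (covering over packing). $\chi(\mathbb{E}^{2n})$ is the least number of colors needed to color $\mathbb{E}^{2n}$ so that any two points at distance exactly $1$ receive different colors. *)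

theory Defs
  imports "HOL-Analysis.Analysis" "HOL-Library.Extended_Nat"
begin

definition eisenstein_integers :: "complex set" where
  "eisenstein_integers =
     {of_int a + of_int b * exp (2 * of_real pi * \<i> / 3) | a b :: int. True}"

text \<open>
  The predicate \<^term>\<open>vec.independent\<close> is linear independence with respect to the scalar
  multiplication \<open>*s\<close>, so over the field \<^typ>\<open>complex\<close> here (the unqualified
  \<^term>\<open>independent\<close> would be independence over the reals).  Being a predicate on sets, it has
  to be complemented by injectivity of the family \<open>v\<close>, which consists of \<open>CARD('n)\<close> vectors.
\<close>

definition eisenstein_lattice :: "(complex ^ 'n) set \<Rightarrow> bool" where
  "eisenstein_lattice \<Lambda> \<longleftrightarrow>
     (\<exists>v :: 'n \<Rightarrow> complex ^ 'n.
        inj v \<and> vec.independent (range v) \<and>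
        \<Lambda> = {\<Sum>i\<in>UNIV. \<xi> i *s v i | \<xi>. \<forall>i. \<xi> i \<in> eisenstein_integers})"

text \<open>
  The norm on \<^typ>\<open>complex ^ 'n\<close> is the Hermitian one, i.e. the Euclidean norm of the
  underlying real space of dimension \<open>2 * CARD('n)\<close>.  For a full rank lattice, both infima
  below are attained, so that they are the minima of the usual definitions.
\<close>

definition packing_radius :: "'a::real_normed_vector set \<Rightarrow> real" where
  "packing_radius \<Lambda> = Inf {norm x | x. x \<in> \<Lambda> \<and> x \<noteq> 0} / 2"

definition covering_radius :: "'a::real_normed_vector set \<Rightarrow> real" where
  "covering_radius \<Lambda> = Inf {R. (\<Union>x\<in>\<Lambda>. cball x R) = UNIV}"

definition covering_packing_ratio :: "'a::real_normed_vector set \<Rightarrow> real" where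
  "covering_packing_ratio \<Lambda> = covering_radius \<Lambda> / packing_radius \<Lambda>"

definition unit_distance_coloring :: "'a::metric_space set \<Rightarrow> nat \<Rightarrow> ('a \<Rightarrow> nat) \<Rightarrow> bool" where
  "unit_distance_coloring X k c \<longleftrightarrow>
     c ` X \<subseteq> {..<k} \<and> (\<forall>x\<in>X. \<forall>y\<in>X. dist x y = 1 \<longrightarrow> c x \<noteq> c y)"

text \<open>
  The value is \<open>\<infinity>\<close> (the infimum of the empty set) if no finite number of colors suffices.
\<close>

definition chromatic_number :: "'a::metric_space set \<Rightarrow> enat" where
  "chromatic_number X = Inf {enat k | k. \<exists>c. unit_distance_coloring X k c}"

end

theory Submission imports Defs begin

text \<open>
  Let \<open>r\<close> and \<open>R\<close> be the packing and covering radius.  The element \<open>\<beta> = 3 + \<omega>\<close> has norm \<open>7\<close>, so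
  \<open>\<beta>\<Lambda>\<close> has index \<open>7^n\<close> in \<open>\<Lambda>\<close>; a point is colored by the class modulo \<open>\<beta>\<Lambda>\<close> of a nearest lattice
  point.  Two points with the same nearest lattice point are at distance at most \<open>2R \<le> 3r\<close>.
  Otherwise their nearest lattice points differ by some \<open>w = \<beta>\<lambda> = 2\<lambda> + (1 + \<omega>)\<lambda>\<close>.  A point \<open>p\<close> of
  the Voronoi cell of \<open>0\<close> satisfies \<open>\<langle>p, \<mu>\<rangle> \<le> |\<mu>|\<^sup>2/2\<close> for all \<open>\<mu> \<in> \<Lambda>\<close>; using this for \<open>\<lambda>\<close> and
  \<open>(1 + \<omega>)\<lambda>\<close>, both of length \<open>|\<lambda>|\<close>, gives \<open>\<langle>p, w\<rangle> \<le> 3|\<lambda>|\<^sup>2/2\<close>.  Hence the difference of the two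
  points has inner product at least \<open>7|\<lambda>|\<^sup>2 - 3|\<lambda>|\<^sup>2\<close> with \<open>w\<close>, and therefore length at least
  \<open>4|\<lambda>|/\<surd>7 \<ge> 8r/\<surd>7 > 3r\<close>.  So all distances strictly between \<open>3r\<close> and \<open>8r/\<surd>7\<close> are avoided.
\<close>

section \<open>Arithmetic of the Eisenstein integers\<close>

abbreviation omega :: complex where
  "omega \<equiv> exp (2 * of_real pi * \<i> / 3)"

lemma omega_eq_Complex: "omega = Complex (- 1 / 2) (sqrt 3 / 2)"
proof -
  have "omega = cis (2 * pi / 3)"
    by (simp add: cis_conv_exp mult_ac)
  then show ?thesis
    by (simp add: complex_eq_iff cos_120 sin_120)
qed

lemma omega_square: "omega * omega = - 1 - omega"
  by (simp add: omega_eq_Complex complex_eq_iff)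

lemma norm_one_plus_omega: "norm (1 + omega) = 1"
  by (simp add: omega_eq_Complex cmod_def power_divide)

lemma norm_three_plus_omega: "norm (3 + omega) = sqrt 7"
  by (simp add: omega_eq_Complex cmod_def power_divide)

lemma eisenstein_integersI: "of_int a + of_int b * omega \<in> eisenstein_integers"
  unfolding eisenstein_integers_def by blast

lemma eisenstein_integersE:
  assumes "z \<in> eisenstein_integers"
  obtains a b :: int where "z = of_int a + of_int b * omega"
  using assms unfolding eisenstein_integers_def by blast

lemma eisenstein_integers_0: "0 \<in> eisenstein_integers"
  using eisenstein_integersI[of 0 0] by simp

lemma eisenstein_integers_1: "1 \<in> eisenstein_integers"
  using eisenstein_integersI[of 1 0] by simp

lemma eisenstein_integers_one_plus_omega: "1 + omega \<in> eisenstein_integers"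
  using eisenstein_integersI[of 1 1] by simp

lemma eisenstein_integers_diff:
  assumes "z \<in> eisenstein_integers" "w \<in> eisenstein_integers"
  shows "z - w \<in> eisenstein_integers"
proof -
  obtain a b c d :: int where "z = of_int a + of_int b * omega" "w = of_int c + of_int d * omega"
    using assms by (elim eisenstein_integersE)
  then have "z - w = of_int (a - c) + of_int (b - d) * omega"
    by (simp add: algebra_simps)
  then show ?thesis
    using eisenstein_integersI by metis
qed

lemma eisenstein_integers_mult:
  assumes "z \<in> eisenstein_integers" "w \<in> eisenstein_integers"
  shows "z * w \<in> eisenstein_integers"
proof -
  obtain a b c d :: int where *: "z = of_int a + of_int b * omega" "w = of_int c + of_int d * omega"
    using assms by (elim eisenstein_integersE)
  have "z * w = of_int a * of_int c + (of_int a * of_int d + of_int b * of_int c) * omega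
      + of_int b * of_int d * (omega * omega)"
    unfolding * by (simp add: algebra_simps)
  also have "\<dots> = of_int (a * c - b * d) + of_int (a * d + b * c - b * d) * omega"
    unfolding omega_square by (simp add: algebra_simps)
  finally show ?thesis
    using eisenstein_integersI by metis
qed

text \<open>The squared modulus is the value of the integral form
  \<open>a * a - a * b + b * b\<close>, and a positive integer is at least 1.\<close>

lemma norm_eisenstein_integer_ge_1:
  assumes "z \<in> eisenstein_integers" "z \<noteq> 0"
  shows "1 \<le> norm z"
proof -
  obtain a b :: int where z: "z = of_int a + of_int b * omega"
    using assms(1) by (rule eisenstein_integersE)
  have "(norm z)\<^sup>2 = (real_of_int a - b / 2)\<^sup>2 + (b * sqrt 3 / 2)\<^sup>2"
    by (simp add: z omega_eq_Complex cmod_power2)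
  also have "\<dots> = of_int (a * a - a * b + b * b)"
    by (simp add: power2_eq_square algebra_simps)
  finally have sq: "(norm z)\<^sup>2 = of_int (a * a - a * b + b * b)" .
  have "(norm z)\<^sup>2 > 0"
    using assms(2) by simp
  then have "1 \<le> (norm z)\<^sup>2"
    unfolding sq of_int_0_less_iff of_int_1_le_iff by simp
  then show ?thesis
    using power2_le_imp_le[of 1 "norm z"] by simp
qed

text \<open>Both coordinates with respect to the basis 1, \<open>omega\<close> are rounded down. The
  bound 2 is crude; it serves only to make the covering radius finite.\<close>

lemma eisenstein_integer_near:
  obtains w where "w \<in> eisenstein_integers" "norm (z - w) \<le> 2"
proof -
  define y where "y = 2 * Im z / sqrt 3"
  define x where "x = Re z + y / 2"
  have z: "z = of_real x + of_real y * omega"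
    by (simp add: x_def y_def omega_eq_Complex complex_eq_iff)
  define w where "w = of_int \<lfloor>x\<rfloor> + of_int \<lfloor>y\<rfloor> * omega"
  have "z - w = of_real (x - of_int \<lfloor>x\<rfloor>) + of_real (y - of_int \<lfloor>y\<rfloor>) * omega"
    unfolding z w_def by (simp add: algebra_simps)
  then have "norm (z - w) \<le> norm (complex_of_real (x - of_int \<lfloor>x\<rfloor>))
      + norm (of_real (y - of_int \<lfloor>y\<rfloor>) * omega)"
    by (metis norm_triangle_ineq)
  also have "\<dots> = \<bar>x - of_int \<lfloor>x\<rfloor>\<bar> + \<bar>y - of_int \<lfloor>y\<rfloor>\<bar>"
    by (simp only: norm_mult norm_of_real) simp
  also have "\<dots> \<le> 2"
    by linarith
  finally show ?thesis
    using that eisenstein_integersI w_def by blast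
qed

text \<open>
  Since \<open>(3 + \<omega>)(p + q\<omega>) = (3p - q) + (p + 2q)\<omega>\<close>, reduction modulo \<open>3 + \<omega>\<close> sends \<open>\<omega>\<close> to \<open>-3\<close>.
\<close>

lemma eisenstein_residue:
  obtains h :: "complex \<Rightarrow> int" where
    "\<And>z. h z \<in> {0..<7}"
    "\<And>z w. z \<in> eisenstein_integers \<Longrightarrow> w \<in> eisenstein_integers \<Longrightarrow> h z = h w
      \<Longrightarrow> \<exists>u\<in>eisenstein_integers. z - w = (3 + omega) * u"
proof -
  have "\<forall>z. \<exists>a b :: int. z \<in> eisenstein_integers \<longrightarrow> z = of_int a + of_int b * omega"
    by (meson eisenstein_integersE)
  then obtain a b :: "complex \<Rightarrow> int" where
    ab: "\<And>z. z \<in> eisenstein_integers \<Longrightarrow> z = of_int (a z) + of_int (b z) * omega"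
    by metis
  define h where "h z = (a z - 3 * b z) mod 7" for z
  show ?thesis
  proof
    show "h z \<in> {0..<7}" for z
      by (simp add: h_def)
    fix z w assume z: "z \<in> eisenstein_integers" and w: "w \<in> eisenstein_integers" and "h z = h w"
    then have "7 dvd (a z - 3 * b z) - (a w - 3 * b w)"
      unfolding h_def by (simp add: mod_eq_dvd_iff)
    then obtain k where "(a z - 3 * b z) - (a w - 3 * b w) = 7 * k"
      by blast
    then have a: "a z - a w = 3 * (b z - b w) + 7 * k"
      by (simp add: algebra_simps)
    define e where "e = b z - b w"
    \<comment> \<open>p = \<open>e + 2 * k\<close> and q = \<open>- k\<close> solve 3p - q =
      \<open>3 * e + 7 * k\<close> and p + 2q = \<open>e\<close>.\<close>
    define u where "u = of_int (e + 2 * k) + of_int (- k) * omega"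
    have "z - w = of_int (a z - a w) + of_int (b z - b w) * omega"
      by (subst ab[OF z], subst ab[OF w]) (simp add: algebra_simps)
    also have "\<dots> = of_int (3 * e + 7 * k) + of_int e * omega"
      unfolding a e_def ..
    also have "\<dots> = 3 * of_int (e + 2 * k) + (of_int (e + 2 * k) - 3 * of_int k) * omega
        - of_int k * (omega * omega)"
      unfolding omega_square by (simp add: algebra_simps)
    also have "\<dots> = (3 + omega) * u"
      unfolding u_def by (simp add: algebra_simps)
    finally show "\<exists>u\<in>eisenstein_integers. z - w = (3 + omega) * u"
      using eisenstein_integersI u_def by blast
  qed
qed

section \<open>Eisenstein lattices in coordinates\<close>

lemma norm_vector_smult:
  fixes x :: "complex ^ 'n"
  shows "norm (c *s x) = norm c * norm x"
  by (simp add: norm_vec_def norm_mult L2_set_right_distrib)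

lemma bounded_linear_complex_matrix_vector_mult:
  fixes A :: "complex ^ 'n ^ 'm"
  shows "bounded_linear (\<lambda>x. A *v x)"
proof -
  have "linear (\<lambda>x. A *v x)"
    by (rule linearI)
      (simp_all add: matrix_vector_mult_def vec_eq_iff distrib_left sum.distrib
        scaleR_sum_right)
  then show ?thesis
    by (simp add: linear_conv_bounded_linear)
qed

text \<open>\<open>A\<close> has the lattice basis as columns and \<open>B\<close> is its inverse,
  so \<open>B *v x\<close> lists the coordinates of \<open>x\<close>. Closure, discreteness,
  covering and residues thereby reduce to single Eisenstein integers.\<close>

lemma eisenstein_lattice_matrix:
  fixes \<Lambda> :: "(complex ^ 'n) set"
  assumes "eisenstein_lattice \<Lambda>"
  obtains A B :: "complex ^ 'n ^ 'n" where
    "\<And>x. A *v (B *v x) = x" "\<And>x. B *v (A *v x) = x"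
    "\<And>x. x \<in> \<Lambda> \<longleftrightarrow> (\<forall>i. (B *v x) $ i \<in> eisenstein_integers)"
proof -
  obtain v :: "'n \<Rightarrow> complex ^ 'n" where inj: "inj v" and indep: "vec.independent (range v)"
    and \<Lambda>: "\<Lambda> = {\<Sum>i\<in>UNIV. \<xi> i *s v i | \<xi>. \<forall>i. \<xi> i \<in> eisenstein_integers}"
    using assms unfolding eisenstein_lattice_def by blast
  define A :: "complex ^ 'n ^ 'n" where "A = (\<chi> i j. v j $ i)"
  have col: "column j A = v j" for j
    by (simp add: A_def column_def vec_eq_iff)
  have "c i = 0" if "(\<Sum>i\<in>UNIV. c i *s column i A) = 0" for c i
  proof -
    \<comment> \<open>Independence concerns the set \<open>range v\<close>, so coefficients indexed
      by \<open>i\<close> are moved to vectors along \<open>inv v\<close>.\<close>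
    have "(\<Sum>x\<in>range v. c (inv v x) *s x) = 0"
      using that by (simp add: sum.reindex inj col)
    then have "c (inv v (v i)) = 0"
      using vec.independentD[OF indep, of "range v" "\<lambda>x. c (inv v x)"] by auto
    then show ?thesis
      by (simp add: inj)
  qed
  then obtain B where BA: "B ** A = mat 1"
    using matrix_left_invertible_independent_columns[of A] by blast
  then have AB: "A ** B = mat 1"
    by (simp add: matrix_left_right_inverse)
  have 1: "A *v (B *v x) = x" and 2: "B *v (A *v x) = x" for x
    by (simp_all add: matrix_vector_mul_assoc AB BA)
  have sum: "A *v \<xi> = (\<Sum>i\<in>UNIV. \<xi> $ i *s v i)" for \<xi>
    by (simp add: matrix_mult_sum col)
  have "x \<in> \<Lambda> \<longleftrightarrow> (\<forall>i. (B *v x) $ i \<in> eisenstein_integers)" for x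
  proof
    assume "x \<in> \<Lambda>"
    then obtain \<xi> where \<xi>: "x = (\<Sum>i\<in>UNIV. \<xi> i *s v i)" "\<forall>i. \<xi> i \<in> eisenstein_integers"
      unfolding \<Lambda> by blast
    then have "x = A *v (\<chi> i. \<xi> i)"
      by (simp add: sum)
    then show "\<forall>i. (B *v x) $ i \<in> eisenstein_integers"
      using \<xi>(2) by (simp add: 2)
  next
    assume "\<forall>i. (B *v x) $ i \<in> eisenstein_integers"
    moreover have "x = (\<Sum>i\<in>UNIV. (B *v x) $ i *s v i)"
      using sum[of "B *v x"] by (simp add: 1)
    ultimately show "x \<in> \<Lambda>"
      unfolding \<Lambda> by blast
  qed
  then show ?thesis
    using that 1 2 by blast
qed

lemma eisenstein_lattice_0:
  assumes "eisenstein_lattice \<Lambda>"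
  shows "0 \<in> \<Lambda>"
  using assms by (elim eisenstein_lattice_matrix) (simp add: eisenstein_integers_0)

lemma eisenstein_lattice_diff:
  assumes "eisenstein_lattice \<Lambda>" "x \<in> \<Lambda>" "y \<in> \<Lambda>"
  shows "x - y \<in> \<Lambda>"
  using assms
  by (elim eisenstein_lattice_matrix) (simp add: matrix_vector_mult_diff_distrib eisenstein_integers_diff)

lemma eisenstein_lattice_uminus:
  assumes "eisenstein_lattice \<Lambda>" "x \<in> \<Lambda>"
  shows "- x \<in> \<Lambda>"
  using eisenstein_lattice_diff[OF assms(1) eisenstein_lattice_0[OF assms(1)] assms(2)] by simp

lemma eisenstein_lattice_add:
  assumes "eisenstein_lattice \<Lambda>" "x \<in> \<Lambda>" "y \<in> \<Lambda>"
  shows "x + y \<in> \<Lambda>"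
  using eisenstein_lattice_diff[OF assms(1,2) eisenstein_lattice_uminus[OF assms(1,3)]] by simp

lemma eisenstein_lattice_smult:
  assumes "eisenstein_lattice \<Lambda>" "c \<in> eisenstein_integers" "x \<in> \<Lambda>"
  shows "c *s x \<in> \<Lambda>"
  using assms
  by (elim eisenstein_lattice_matrix) (simp add: vector_scalar_commute eisenstein_integers_mult)

text \<open>A nonzero lattice vector has a nonzero coordinate, of modulus at least 1, and
  \<open>B\<close> enlarges norms by a factor of at most \<open>K\<close>.\<close>

lemma eisenstein_lattice_discrete:
  fixes \<Lambda> :: "(complex ^ 'n) set"
  assumes "eisenstein_lattice \<Lambda>"
  obtains c where "c > 0" "\<And>x. x \<in> \<Lambda> \<Longrightarrow> x \<noteq> 0 \<Longrightarrow> c \<le> norm x"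
proof -
  obtain A B :: "complex ^ 'n ^ 'n" where AB: "\<And>x. A *v (B *v x) = x"
    and \<Lambda>: "\<And>x. x \<in> \<Lambda> \<longleftrightarrow> (\<forall>i. (B *v x) $ i \<in> eisenstein_integers)"
    using assms by (elim eisenstein_lattice_matrix) blast
  obtain K where K: "K > 0" "\<And>x. norm (B *v x) \<le> norm x * K"
    using bounded_linear.pos_bounded[OF bounded_linear_complex_matrix_vector_mult] by blast
  show ?thesis
  proof
    show "1 / K > 0"
      using K by simp
    fix x assume x: "x \<in> \<Lambda>" "x \<noteq> 0"
    have "B *v x \<noteq> 0"
      using AB[of x] x(2) by auto
    then obtain i where "(B *v x) $ i \<noteq> 0"
      by (auto simp: vec_eq_iff)
    then have "1 \<le> norm ((B *v x) $ i)"
      using norm_eisenstein_integer_ge_1 x(1) \<Lambda> by blast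
    also have "\<dots> \<le> norm x * K"
      using K(2) Finite_Cartesian_Product.norm_nth_le order_trans by blast
    finally show "1 / K \<le> norm x"
      using K(1) by (simp add: field_simps)
  qed
qed

text \<open>Every coordinate is rounded to an Eisenstein integer, and \<open>A\<close> enlarges the
  bounded error by a factor of at most \<open>K\<close>. This makes the set in
  \<open>covering_radius\<close> nonempty, so that its infimum is meaningful.\<close>

lemma eisenstein_lattice_cobounded:
  fixes \<Lambda> :: "(complex ^ 'n) set"
  assumes "eisenstein_lattice \<Lambda>"
  obtains R where "(\<Union>x\<in>\<Lambda>. cball x R) = UNIV"
proof -
  obtain A B :: "complex ^ 'n ^ 'n" where AB: "\<And>x. A *v (B *v x) = x" and BA: "\<And>x. B *v (A *v x) = x"
    and \<Lambda>: "\<And>x. x \<in> \<Lambda> \<longleftrightarrow> (\<forall>i. (B *v x) $ i \<in> eisenstein_integers)"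
    using assms by (elim eisenstein_lattice_matrix) blast
  obtain K where K: "K > 0" "\<And>x. norm (A *v x) \<le> norm x * K"
    using bounded_linear.pos_bounded[OF bounded_linear_complex_matrix_vector_mult] by blast
  obtain f where f: "\<And>z. f z \<in> eisenstein_integers" "\<And>z. norm (z - f z) \<le> 2"
    by (metis eisenstein_integer_near)
  have "\<exists>u\<in>\<Lambda>. x \<in> cball u (2 * real CARD('n) * K)" for x
  proof
    define \<xi> where "\<xi> = (\<chi> i. f ((B *v x) $ i))"
    show "A *v \<xi> \<in> \<Lambda>"
      by (simp add: \<Lambda> BA \<xi>_def f)
    have "norm (B *v x - \<xi>) \<le> (\<Sum>i\<in>UNIV. norm ((B *v x - \<xi>) $ i))"
      unfolding norm_vec_def by (rule L2_set_le_sum) simp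
    also have "\<dots> \<le> (\<Sum>i\<in>(UNIV :: 'n set). 2)"
      by (intro sum_mono) (simp add: \<xi>_def f)
    finally have "norm (B *v x - \<xi>) \<le> 2 * real CARD('n)"
      by simp
    then have "norm (A *v (B *v x - \<xi>)) \<le> 2 * real CARD('n) * K"
      using K order_trans mult_right_mono less_imp_le by metis
    then show "x \<in> cball (A *v \<xi>) (2 * real CARD('n) * K)"
      by (simp add: matrix_vector_mult_diff_distrib AB dist_norm norm_minus_commute)
  qed
  then show ?thesis
    using that by blast
qed

section \<open>Radii, nearest points and residue classes of a lattice\<close>

lemma packing_radius_le:
  assumes "x \<in> \<Lambda>" "x \<noteq> 0"
  shows "2 * packing_radius \<Lambda> \<le> norm x"
proof -
  have "Inf {norm x | x. x \<in> \<Lambda> \<and> x \<noteq> 0} \<le> norm x"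
    using assms by (intro cInf_lower bdd_belowI[of _ 0]) auto
  then show ?thesis
    by (simp add: packing_radius_def)
qed

lemma packing_radius_pos:
  fixes \<Lambda> :: "(complex ^ 'n) set"
  assumes "eisenstein_lattice \<Lambda>"
  shows "packing_radius \<Lambda> > 0"
proof -
  obtain c where c: "c > 0" "\<And>x. x \<in> \<Lambda> \<Longrightarrow> x \<noteq> 0 \<Longrightarrow> c \<le> norm x"
    using eisenstein_lattice_discrete[OF assms] by blast
  obtain A B :: "complex ^ 'n ^ 'n" where AB: "\<And>x. B *v (A *v x) = x"
    and \<Lambda>: "\<And>x. x \<in> \<Lambda> \<longleftrightarrow> (\<forall>i. (B *v x) $ i \<in> eisenstein_integers)"
    using assms by (elim eisenstein_lattice_matrix) blast
  \<comment> \<open>The lattice vector with all coordinates 1 witnesses that the set of norms is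
    nonempty, as a lower bound on its \<open>Inf\<close> requires.\<close>
  have "A *v 1 \<in> \<Lambda>"
    by (simp add: \<Lambda> AB eisenstein_integers_1)
  moreover have "A *v 1 \<noteq> 0"
    using AB[of 1] by auto
  ultimately have "c \<le> Inf {norm x | x. x \<in> \<Lambda> \<and> x \<noteq> 0}"
    using c by (intro cInf_greatest) auto
  then show ?thesis
    using c(1) by (simp add: packing_radius_def)
qed

text \<open>A uniformly discrete set is closed, so the distance from \<open>x\<close> is attained.
  The attained distance is at most every radius \<open>R\<close> that covers, hence at most their
  infimum, whether or not that infimum itself covers.\<close>

lemma eisenstein_lattice_nearest_point:
  assumes "eisenstein_lattice \<Lambda>"
  obtains u where "u \<in> \<Lambda>" "\<And>v. v \<in> \<Lambda> \<Longrightarrow> dist x u \<le> dist x v" "dist x u \<le> covering_radius \<Lambda>"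
proof -
  obtain c where c: "c > 0" "\<And>x. x \<in> \<Lambda> \<Longrightarrow> x \<noteq> 0 \<Longrightarrow> c \<le> norm x"
    using eisenstein_lattice_discrete[OF assms] by blast
  have "closed \<Lambda>"
  proof (rule discrete_imp_closed[OF c(1)], intro ballI impI)
    fix y z assume "y \<in> \<Lambda>" "z \<in> \<Lambda>" "dist z y < c"
    then show "z = y"
      using c(2)[of "z - y"] eisenstein_lattice_diff[OF assms] by (auto simp: dist_norm)
  qed
  then obtain u where u: "u \<in> \<Lambda>" "\<And>v. v \<in> \<Lambda> \<Longrightarrow> dist x u \<le> dist x v"
    using distance_attains_inf[of \<Lambda> x] eisenstein_lattice_0[OF assms] by blast
  have "dist x u \<le> covering_radius \<Lambda>"
    unfolding covering_radius_def
  proof (rule cInf_greatest)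
    show "{R. (\<Union>x\<in>\<Lambda>. cball x R) = UNIV} \<noteq> {}"
      using eisenstein_lattice_cobounded[OF assms] by blast
    fix R assume "R \<in> {R. (\<Union>x\<in>\<Lambda>. cball x R) = UNIV}"
    then obtain v where "v \<in> \<Lambda>" "x \<in> cball v R"
      by blast
    then show "dist x u \<le> R"
      using u(2)[of v] by (simp add: dist_commute)
  qed
  then show ?thesis
    using that u by blast
qed

text \<open>Residues are taken coordinatewise, and the \<open>7 ^ CARD('n)\<close> residue vectors
  are numbered by a bijection \<open>e\<close>.\<close>

lemma eisenstein_lattice_residue:
  fixes \<Lambda> :: "(complex ^ 'n) set"
  assumes "eisenstein_lattice \<Lambda>"
  obtains h :: "complex ^ 'n \<Rightarrow> nat" where
    "\<And>x. h x < 7 ^ CARD('n)"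
    "\<And>x y. x \<in> \<Lambda> \<Longrightarrow> y \<in> \<Lambda> \<Longrightarrow> h x = h y \<Longrightarrow> \<exists>u\<in>\<Lambda>. x - y = (3 + omega) *s u"
proof -
  obtain A B :: "complex ^ 'n ^ 'n" where AB: "\<And>x. A *v (B *v x) = x" and BA: "\<And>x. B *v (A *v x) = x"
    and \<Lambda>: "\<And>x. x \<in> \<Lambda> \<longleftrightarrow> (\<forall>i. (B *v x) $ i \<in> eisenstein_integers)"
    using assms by (elim eisenstein_lattice_matrix) blast
  obtain h :: "complex \<Rightarrow> int" where h: "\<And>z. h z \<in> {0..<7}"
    "\<And>z w. z \<in> eisenstein_integers \<Longrightarrow> w \<in> eisenstein_integers \<Longrightarrow> h z = h w
      \<Longrightarrow> \<exists>u\<in>eisenstein_integers. z - w = (3 + omega) * u"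
    using eisenstein_residue by blast
  define S where "S = (UNIV :: 'n set) \<rightarrow>\<^sub>E {0..<7 :: int}"
  have "finite S" "card S = 7 ^ CARD('n)"
    unfolding S_def by (auto simp: card_PiE intro: finite_PiE)
  then obtain e where e: "bij_betw e S {0..<7 ^ CARD('n) :: nat}"
    using ex_bij_betw_finite_nat by metis
  define g where "g x = (\<lambda>i. h ((B *v x) $ i))" for x
  have gS: "g x \<in> S" for x
    using h(1) by (simp add: g_def S_def PiE_iff)
  show ?thesis
  proof
    show "e (g x) < 7 ^ CARD('n)" for x
      using bij_betw_apply[OF e gS] by simp
    fix x y assume x: "x \<in> \<Lambda>" and y: "y \<in> \<Lambda>" and "e (g x) = e (g y)"
    then have "g x = g y"
      using bij_betw_imp_inj_on[OF e] gS by (meson inj_onD)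
    then have "\<forall>i. \<exists>u\<in>eisenstein_integers. (B *v x) $ i - (B *v y) $ i = (3 + omega) * u"
      using h(2) x y \<Lambda> by (metis g_def)
    then obtain u where u: "\<And>i. u i \<in> eisenstein_integers"
      "\<And>i. (B *v x) $ i - (B *v y) $ i = (3 + omega) * u i"
      by metis
    have "B *v x - B *v y = (3 + omega) *s (\<chi> i. u i)"
      by (simp add: vec_eq_iff u(2) distrib_right)
    then have "A *v (B *v x - B *v y) = (3 + omega) *s (A *v (\<chi> i. u i))"
      by (simp only: vector_scalar_commute)
    then have "x - y = (3 + omega) *s (A *v (\<chi> i. u i))"
      by (simp add: matrix_vector_mult_diff_distrib AB)
    moreover have "A *v (\<chi> i. u i) \<in> \<Lambda>"
      by (simp add: \<Lambda> BA u(1))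
    ultimately show "\<exists>u\<in>\<Lambda>. x - y = (3 + omega) *s u"
      by blast
  qed
qed

section \<open>Separation of Voronoi cells and the coloring\<close>

lemma nearest_point_inner_le:
  fixes x :: "'a::real_inner"
  assumes "dist x u \<le> dist x (u + \<mu>)"
  shows "2 * ((x - u) \<bullet> \<mu>) \<le> (norm \<mu>)\<^sup>2"
proof -
  \<comment> \<open>Expanding the squares cancels the square of \<open>norm (x - u)\<close> and
    leaves the half-space inequality of the Voronoi cell.\<close>
  have "(norm (x - u))\<^sup>2 \<le> (norm (x - u - \<mu>))\<^sup>2"
    using assms by (intro power_mono) (simp_all add: dist_norm algebra_simps)
  then show ?thesis
    by (simp add: power2_norm_eq_inner inner_diff inner_commute)
qed

lemma eisenstein_voronoi_separation:
  fixes \<Lambda> :: "(complex ^ 'n) set"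
  assumes lat: "eisenstein_lattice \<Lambda>" and l: "l \<in> \<Lambda>" "l \<noteq> 0"
    and u: "u \<in> \<Lambda>" "\<And>v. v \<in> \<Lambda> \<Longrightarrow> dist x u \<le> dist x v"
    and u': "u' \<in> \<Lambda>" "\<And>v. v \<in> \<Lambda> \<Longrightarrow> dist y u' \<le> dist y v"
    and diff: "u' - u = (3 + omega) *s l"
  shows "8 * packing_radius \<Lambda> \<le> sqrt 7 * dist x y"
proof -
  define m where "m = (1 + omega) *s l"
  have m: "m \<in> \<Lambda>" "norm m = norm l"
    unfolding m_def norm_vector_smult norm_one_plus_omega
    using eisenstein_lattice_smult[OF lat eisenstein_integers_one_plus_omega l(1)] by simp_all
  define w where "w = u' - u"
  have w: "w = 2 *\<^sub>R l + m"
    unfolding w_def diff m_def by (simp add: vec_eq_iff scaleR_conv_of_real algebra_simps)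
  have normw: "norm w = sqrt 7 * norm l"
    by (simp only: w_def diff norm_vector_smult norm_three_plus_omega)
  have x: "2 * ((x - u) \<bullet> \<mu>) \<le> (norm \<mu>)\<^sup>2" if "\<mu> \<in> \<Lambda>" for \<mu>
    using nearest_point_inner_le u eisenstein_lattice_add[OF lat] that by blast
  \<comment> \<open>The component of \<open>y - u'\<close> along \<open>w\<close> has to be bounded
    from below, so this cell is tested against negated lattice vectors.\<close>
  have y: "2 * ((y - u') \<bullet> (- \<mu>)) \<le> (norm \<mu>)\<^sup>2" if "\<mu> \<in> \<Lambda>" for \<mu>
    using nearest_point_inner_le[of y u' "- \<mu>"] u' eisenstein_lattice_diff[OF lat] that by simp
  have "(y - x) \<bullet> w = w \<bullet> w + (y - u') \<bullet> w - (x - u) \<bullet> w"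
    by (simp add: w_def inner_diff)
  moreover have "w \<bullet> w = 7 * (norm l)\<^sup>2"
    using normw by (simp add: power_mult_distrib flip: power2_norm_eq_inner)
  moreover have "2 * ((x - u) \<bullet> w) \<le> 3 * (norm l)\<^sup>2"
    using x[OF l(1)] x[OF m(1)] by (simp add: w inner_add_right m(2))
  moreover have "2 * ((y - u') \<bullet> w) \<ge> - 3 * (norm l)\<^sup>2"
    using y[OF l(1)] y[OF m(1)] by (simp add: w inner_add_right m(2))
  \<comment> \<open>Each cell costs at most 3/2 of the 7 in \<open>w \<bullet> w\<close>: 7 - 3/2 -
    3/2 = 4.\<close>
  ultimately have "4 * (norm l)\<^sup>2 \<le> (y - x) \<bullet> w"
    by linarith
  also have "\<dots> \<le> norm (y - x) * norm w"
    by (rule norm_cauchy_schwarz)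
  also have "\<dots> = (sqrt 7 * dist x y) * norm l"
    by (simp add: normw dist_norm norm_minus_commute)
  finally have "4 * norm l \<le> sqrt 7 * dist x y"
    using l(2) by (simp add: power2_eq_square)
  then show ?thesis
    using packing_radius_le[OF l] by linarith
qed

lemma eisenstein_lattice_coloring:
  fixes \<Lambda> :: "(complex ^ 'n) set"
  assumes lat: "eisenstein_lattice \<Lambda>" and ratio: "covering_packing_ratio \<Lambda> \<le> 3 / 2"
  obtains c :: "complex ^ 'n \<Rightarrow> nat" where "unit_distance_coloring UNIV (7 ^ CARD('n)) c"
proof -
  define r where "r = packing_radius \<Lambda>"
  have r: "r > 0"
    unfolding r_def using lat by (rule packing_radius_pos)
  have R: "2 * covering_radius \<Lambda> \<le> 3 * r"
    using ratio r unfolding covering_packing_ratio_def r_def by (simp add: field_simps)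
  \<comment> \<open>Any \<open>t\<close> strictly between \<open>3 * r\<close> and
    \<open>8 * r / sqrt 7\<close>, about 3.02 \<open>r\<close>, is a forbidden distance for the
    coloring; 3.01 is a rational choice of factor.\<close>
  define t where "t = 301 / 100 * r"
  have t: "t > 0" "3 * r < t"
    using r by (simp_all add: t_def)
  have "sqrt 7 < 800 / 301"
    by (rule real_less_lsqrt) (simp_all add: power2_eq_square)
  then have t': "sqrt 7 * t < 8 * r"
    using r by (simp add: t_def)
  have "\<forall>x. \<exists>u. u \<in> \<Lambda> \<and> (\<forall>v\<in>\<Lambda>. dist x u \<le> dist x v) \<and> dist x u \<le> covering_radius \<Lambda>"
    by (meson eisenstein_lattice_nearest_point[OF lat])
  then obtain N where N: "\<And>x. N x \<in> \<Lambda>" "\<And>x v. v \<in> \<Lambda> \<Longrightarrow> dist x (N x) \<le> dist x v"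
    "\<And>x. dist x (N x) \<le> covering_radius \<Lambda>"
    by metis
  obtain h :: "complex ^ 'n \<Rightarrow> nat" where h: "\<And>x. h x < 7 ^ CARD('n)"
    "\<And>x y. x \<in> \<Lambda> \<Longrightarrow> y \<in> \<Lambda> \<Longrightarrow> h x = h y \<Longrightarrow> \<exists>u\<in>\<Lambda>. x - y = (3 + omega) *s u"
    using eisenstein_lattice_residue[OF lat] by blast
  have avoid: "h (N x) \<noteq> h (N y)" if d: "dist x y = t" for x y
  proof
    assume "h (N x) = h (N y)"
    then obtain l where l: "l \<in> \<Lambda>" "N y - N x = (3 + omega) *s l"
      using h(2)[of "N y" "N x"] N(1) by metis
    show False
    proof (cases "l = 0")
      case True
      then have "N y = N x"
        using l(2) by simp
      then have "dist x y \<le> 2 * covering_radius \<Lambda>"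
        using N(3)[of x] N(3)[of y] dist_triangle2[of x y "N x"] by simp
      then show False
        using d R t by linarith
    next
      case False
      have "8 * packing_radius \<Lambda> \<le> sqrt 7 * dist x y"
        using eisenstein_voronoi_separation[OF lat l(1) False N(1,2) N(1,2) l(2)] .
      then show False
        using d t' r_def by simp
    qed
  qed
  \<comment> \<open>Scaling the argument by \<open>t\<close> turns the avoided distance
    \<open>t\<close> into distance 1.\<close>
  have "unit_distance_coloring UNIV (7 ^ CARD('n)) (\<lambda>x. h (N (t *\<^sub>R x)))"
    unfolding unit_distance_coloring_def
  proof (intro conjI ballI impI)
    show "range (\<lambda>x. h (N (t *\<^sub>R x))) \<subseteq> {..<7 ^ CARD('n)}"
      using h(1) by auto
    fix x y :: "complex ^ 'n" assume "dist x y = 1"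
    then have "dist (t *\<^sub>R x) (t *\<^sub>R y) = t"
      using t(1) by (simp add: dist_norm flip: scaleR_diff_right)
    then show "h (N (t *\<^sub>R x)) \<noteq> h (N (t *\<^sub>R y))"
      by (rule avoid)
  qed
  then show ?thesis
    using that by blast
qed

lemma enat_power: "enat (a ^ n) = enat a ^ n"
  by (induction n) (simp_all add: one_enat_def flip: times_enat_simps(1))

theorem theorem2p5:
  assumes "\<exists>\<Lambda> :: (complex ^ 'n) set. eisenstein_lattice \<Lambda> \<and> covering_packing_ratio \<Lambda> \<le> 3 / 2"
    and "CARD('m::finite) = 2 * CARD('n)"
  shows "chromatic_number (UNIV :: (real ^ 'm) set) \<le> 7 ^ CARD('n)"
proof -
  obtain c :: "complex ^ 'n \<Rightarrow> nat" where c: "unit_distance_coloring UNIV (7 ^ CARD('n)) c"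
    using assms(1) eisenstein_lattice_coloring by blast
  have "DIM(real ^ 'm) = DIM(complex ^ 'n)"
    using assms(2) by simp
  \<comment> \<open>Real inner product spaces of equal dimension are linearly isometric, so the
    coloring pulls back along \<open>f\<close>.\<close>
  then obtain f :: "real ^ 'm \<Rightarrow> complex ^ 'n" where f: "linear f" "\<And>x. norm (f x) = norm x"
    using isomorphisms_UNIV_UNIV by metis
  have "dist (f x) (f y) = dist x y" for x y
    using f by (simp add: dist_norm flip: linear_diff)
  then have "unit_distance_coloring (UNIV :: (real ^ 'm) set) (7 ^ CARD('n)) (c \<circ> f)"
    using c unfolding unit_distance_coloring_def image_subset_iff by simp
  then have "chromatic_number (UNIV :: (real ^ 'm) set) \<le> enat (7 ^ CARD('n))"
    unfolding chromatic_number_def by (intro Inf_lower) blast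
  also have "\<dots> = 7 ^ CARD('n)"
    by (simp add: enat_power numeral_eq_enat)
  finally show ?thesis .
qed

end
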